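(* In the space of four-point metric spaces there exists a nonempty open subset $U$ such that for any $X\in U$ one can find a four-point metric space $X'$ that is not isometric to $X$ and such that $d_{GH}(X,t\Delta_m)=d_{GH}(X',t\Delta_m)$ for all $t>0$ and $m\in\mathbb{N}$.
   Context: $\mathbb{N}=\{1,2,\ldots\}$ and $d_{GH}$ is the Gromov--Hausdorff distance. The space of four-point metric spaces is the set of isometry classes of metric spaces with exactly four points, with the topology induced by the metric $d_{GH}$. $t\Delta_m$ denotes the $m$-point metric space (simplex) all of whose nonzero distances equal $t$. *)

theory Defs
  imports "HOL-Analysis.Analysis"
begin

definition isometric_embedding :: "'a metric \<Rightarrow> 'b metric \<Rightarrow> ('a \<Rightarrow> 'b) \<Rightarrow> bool" where
  "isometric_embedding X Y f \<longleftrightarrow>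
     f \<in> mspace X \<rightarrow> mspace Y \<and>
     (\<forall>x\<in>mspace X. \<forall>y\<in>mspace X. mdist Y (f x) (f y) = mdist X x y)"

definition isometric :: "'a metric \<Rightarrow> 'b metric \<Rightarrow> bool" where
  "isometric X Y \<longleftrightarrow> (\<exists>f. isometric_embedding X Y f \<and> f ` mspace X = mspace Y)"

text \<open>Both distances below take values in the extended half-line, so that they are meaningful
  (possibly infinite) for arbitrary metric spaces.\<close>

definition Hausdorff_dist :: "'a metric \<Rightarrow> 'a set \<Rightarrow> 'a set \<Rightarrow> ennreal" where
  "Hausdorff_dist Z A B =
     Inf {ennreal r |r. r > 0 \<and> A \<subseteq> (\<Union>b\<in>B. mball_of Z b r) \<and> B \<subseteq> (\<Union>a\<in>A. mball_of Z a r)}"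

text \<open>The infimum is over all metric spaces \<open>Z\<close> and all isometric copies of \<open>X\<close> and \<open>Y\<close> in \<open>Z\<close>.
  The Hausdorff distance only depends on the union of the two copies, which injects into the
  disjoint union of \<open>X\<close> and \<open>Y\<close>; hence letting \<open>Z\<close> range over the metric spaces
  with points in the sum type loses no generality.\<close>

definition GH_dist :: "'a metric \<Rightarrow> 'b metric \<Rightarrow> ennreal" where
  "GH_dist X Y =
     Inf {Hausdorff_dist Z (f ` mspace X) (g ` mspace Y) |(Z :: ('a + 'b) metric) f g.
            isometric_embedding X Z f \<and> isometric_embedding Y Z g}"

text \<open>Every finite metric space is isometric to one whose points are natural numbers, so the
  isometry classes are represented by such spaces.\<close>

definition isometry_rel :: "(nat metric \<times> nat metric) set" where
  "isometry_rel = {(X, Y). isometric X Y}"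

definition four_point_space :: "nat metric set set" where
  "four_point_space = {X. card (mspace X) = 4} // isometry_rel"

text \<open>The choice of representatives is immaterial, see \<open>class_dist_eq\<close> below.\<close>

definition class_dist :: "nat metric set \<Rightarrow> nat metric set \<Rightarrow> real" where
  "class_dist A B = enn2real (GH_dist (SOME X. X \<in> A) (SOME Y. Y \<in> B))"

text \<open>\<open>class_dist\<close> is a metric on \<open>four_point_space\<close>: finite spaces at Gromov-Hausdorff distance
  zero are isometric. The locale facts about \<open>mtopology\<close> require this to be proved first.\<close>

definition four_point_topology :: "nat metric set topology" where
  "four_point_topology = Metric_space.mtopology four_point_space class_dist"

text \<open>The space \<open>t\<Delta>\<^sub>m\<close>, meaningful for \<open>t > 0\<close>.\<close>

definition Delta :: "real \<Rightarrow> nat \<Rightarrow> nat metric" where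
  "Delta t m = metric ({..<m}, (\<lambda>i j. if i = j then 0 else t))"

lemma
  assumes "t > 0"
  shows mspace_Delta: "mspace (Delta t m) = {..<m}"
    and mdist_Delta: "mdist (Delta t m) i j = (if i = j then 0 else t)"
proof -
  interpret Metric_space "{..<m}" "\<lambda>i j. if i = j then 0 else t"
    by unfold_locales (use assms in auto)
  show "mspace (Delta t m) = {..<m}" "mdist (Delta t m) i j = (if i = j then 0 else t)"
    by (simp_all add: Delta_def)
qed

lemma isometric_embedding_inj_on:
  assumes "isometric_embedding X Y f"
  shows "inj_on f (mspace X)"
  using assms unfolding isometric_embedding_def inj_on_def
  by (metis Pi_iff mdist_zero)

lemma isometric_embedding_comp:
  assumes "isometric_embedding X Y f" "isometric_embedding Y Z g"
  shows "isometric_embedding X Z (g \<circ> f)"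
  using assms unfolding isometric_embedding_def by (auto simp: Pi_iff)

lemma isometric_refl: "isometric X X"
  unfolding isometric_def isometric_embedding_def by (rule exI[of _ id]) auto

lemma isometric_sym:
  assumes "isometric X Y"
  shows "isometric Y X"
proof -
  obtain f where f: "isometric_embedding X Y f" and im: "f ` mspace X = mspace Y"
    using assms by (auto simp: isometric_def)
  have bij: "bij_betw f (mspace X) (mspace Y)"
    using isometric_embedding_inj_on[OF f] im by (simp add: bij_betw_def)
  define g where "g = inv_into (mspace X) f"
  have gb: "bij_betw g (mspace Y) (mspace X)"
    unfolding g_def by (rule bij_betw_inv_into[OF bij])
  have fg: "f (g y) = y" if "y \<in> mspace Y" for y
    using bij_betw_inv_into_right[OF bij that] by (simp add: g_def)
  have "mdist X (g y) (g y') = mdist Y y y'" if "y \<in> mspace Y" "y' \<in> mspace Y" for y y'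
    using f that fg bij_betwE[OF gb] unfolding isometric_embedding_def by metis
  then show ?thesis
    using gb unfolding isometric_def isometric_embedding_def bij_betw_def by blast
qed

lemma isometric_trans:
  assumes "isometric X Y" "isometric Y Z"
  shows "isometric X Z"
  using assms isometric_embedding_comp unfolding isometric_def by (metis image_comp)

lemma equiv_isometry_rel: "equiv UNIV isometry_rel"
  by (rule equivI)
     (auto simp: isometry_rel_def refl_on_def sym_def trans_def
       intro: isometric_refl isometric_sym isometric_trans)

lemma GH_dist_mono_isometric:
  fixes X X' :: "'a metric" and Y Y' :: "'b metric"
  assumes "isometric X X'" "isometric Y Y'"
  shows "GH_dist X Y \<le> GH_dist X' Y'"
proof -
  obtain h where h: "isometric_embedding X X' h" "h ` mspace X = mspace X'"
    using assms by (auto simp: isometric_def)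
  obtain k where k: "isometric_embedding Y Y' k" "k ` mspace Y = mspace Y'"
    using assms by (auto simp: isometric_def)
  show ?thesis
    unfolding GH_dist_def
  proof (rule Inf_superset_mono, clarify)
    fix Z :: "('a + 'b) metric" and f g
    assume "isometric_embedding X' Z f" "isometric_embedding Y' Z g"
    then have "isometric_embedding X Z (f \<circ> h)" "isometric_embedding Y Z (g \<circ> k)"
      using h k isometric_embedding_comp by blast+
    moreover have "f ` mspace X' = (f \<circ> h) ` mspace X" "g ` mspace Y' = (g \<circ> k) ` mspace Y"
      using h k by (metis image_comp)+
    ultimately show "\<exists>Z' f' g'. Hausdorff_dist Z (f ` mspace X') (g ` mspace Y') =
        Hausdorff_dist Z' (f' ` mspace X) (g' ` mspace Y) \<and>
        isometric_embedding X (Z' :: ('a + 'b) metric) f' \<and> isometric_embedding Y Z' g'"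
      by metis
  qed
qed

lemma GH_dist_cong_isometric:
  fixes X X' :: "'a metric" and Y Y' :: "'b metric"
  assumes "isometric X X'" "isometric Y Y'"
  shows "GH_dist X Y = GH_dist X' Y'"
  using assms by (blast intro: order.antisym GH_dist_mono_isometric isometric_sym)

lemma class_dist_eq:
  "class_dist (isometry_rel `` {X}) (isometry_rel `` {Y}) = enn2real (GH_dist X Y)"
proof -
  have "isometric Z (SOME W. W \<in> isometry_rel `` {Z})" for Z :: "nat metric"
    using someI[of "\<lambda>W. W \<in> isometry_rel `` {Z}" Z] isometric_refl
    by (auto simp: isometry_rel_def)
  then show ?thesis
    unfolding class_dist_def using GH_dist_cong_isometric by metis
qed

end

theory Submission
  imports Defs
begin

text \<open>
  Twice the Gromov-Hausdorff distance is the least distortion of a correspondence. A correspondence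
  with \<open>t\<Delta>\<^sub>m\<close> essentially labels the points of \<open>X\<close> by the \<open>m\<close> vertices, and its distortion
  depends only on the largest distance inside a label class, the smallest distance between two
  classes, and the diameter. Hence the distances to the simplexes see \<open>X\<close> only through the optimal
  partitions of its points.

  Suppose now that the two shortest of the six distances of \<open>X\<close> are disjoint edges \<open>pq\<close> and
  \<open>rs\<close>. Then the optimal partition into three classes merges \<open>pq\<close>, and the optimal
  partition into two classes is \<open>{p, q}, {r, s}\<close>: every other partition into two classes has one of
  the longer four edges inside a class and one of the two shortest edges between the classes. The
  only relevant numbers are therefore \<open>pq\<close>, \<open>rs\<close>, the shortest of the four remaining edges, and
  the diameter (\<open>GH_close_Delta_iff\<close>). The two intermediate edges are invisible. Moving one of them strictly
  between its neighbours in the list of distances changes the isometry class, because it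
  changes the set of distances, but none of the distances to the simplexes
  (\<open>skew_quadruple_twin\<close>).

  The set \<open>U\<close> consists of the spaces in which this pattern holds with strict inequalities
  (\<open>skew_quadruple\<close>). It is open since a correspondence of distortion smaller than all gaps is a
  bijection that preserves the strict order of the distances (\<open>skew_quadruple_stable\<close>).
\<close>

section \<open>Gromov-Hausdorff distance through correspondences\<close>

definition correspondence :: "'a metric \<Rightarrow> 'b metric \<Rightarrow> real \<Rightarrow> ('a \<times> 'b) set \<Rightarrow> bool" where
  "correspondence X Y \<delta> R \<longleftrightarrow> R \<subseteq> mspace X \<times> mspace Y \<and>
     (\<forall>x\<in>mspace X. \<exists>y. (x, y) \<in> R) \<and> (\<forall>y\<in>mspace Y. \<exists>x. (x, y) \<in> R) \<and>
     (\<forall>x y x' y'. (x, y) \<in> R \<longrightarrow> (x', y') \<in> R \<longrightarrow> \<bar>mdist X x x' - mdist Y y y'\<bar> \<le> \<delta>)"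

definition GH_close :: "'a metric \<Rightarrow> 'b metric \<Rightarrow> real \<Rightarrow> bool" where
  "GH_close X Y \<delta> \<longleftrightarrow> (\<exists>R. correspondence X Y \<delta> R)"

lemma correspondenceD:
  assumes "correspondence X Y \<delta> R"
  shows "R \<subseteq> mspace X \<times> mspace Y"
    and "\<And>x. x \<in> mspace X \<Longrightarrow> \<exists>y. (x, y) \<in> R" "\<And>y. y \<in> mspace Y \<Longrightarrow> \<exists>x. (x, y) \<in> R"
    and "\<And>x y x' y'. (x, y) \<in> R \<Longrightarrow> (x', y') \<in> R \<Longrightarrow> \<bar>mdist X x x' - mdist Y y y'\<bar> \<le> \<delta>"
  using assms by (simp_all add: correspondence_def)

lemma GH_closeI:
  assumes "R \<subseteq> mspace X \<times> mspace Y"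
    and "\<And>x. x \<in> mspace X \<Longrightarrow> \<exists>y. (x, y) \<in> R" "\<And>y. y \<in> mspace Y \<Longrightarrow> \<exists>x. (x, y) \<in> R"
    and "\<And>x y x' y'. (x, y) \<in> R \<Longrightarrow> (x', y') \<in> R \<Longrightarrow> \<bar>mdist X x x' - mdist Y y y'\<bar> \<le> \<delta>"
  shows "GH_close X Y \<delta>"
  unfolding GH_close_def correspondence_def using assms by (intro exI[of _ R]) auto

lemma GH_close_mono: "GH_close X Y \<delta> \<Longrightarrow> \<delta> \<le> \<epsilon> \<Longrightarrow> GH_close X Y \<epsilon>"
  unfolding GH_close_def correspondence_def by (meson order.trans)

lemma GH_close_nonneg:
  assumes "GH_close X Y \<delta>" "mspace X \<noteq> {}"
  shows "\<delta> \<ge> 0"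
proof -
  obtain R where "correspondence X Y \<delta> R" using assms(1) by (auto simp: GH_close_def)
  note R = correspondenceD[OF this]
  obtain x y where "(x, y) \<in> R" using R(2) assms(2) by blast
  from R(4)[OF this this] show ?thesis by linarith
qed

lemma GH_close_sym:
  assumes "GH_close X Y \<delta>"
  shows "GH_close Y X \<delta>"
proof -
  obtain R where "correspondence X Y \<delta> R" using assms by (auto simp: GH_close_def)
  note R = correspondenceD[OF this]
  show ?thesis
    by (rule GH_closeI[of "R\<inverse>"]) (use R in \<open>auto simp: abs_minus_commute\<close>)
qed

lemma GH_close_trans:
  assumes "GH_close X Y \<delta>" "GH_close Y Z \<epsilon>"
  shows "GH_close X Z (\<delta> + \<epsilon>)"
proof -
  obtain R where "correspondence X Y \<delta> R" using assms(1) by (auto simp: GH_close_def)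
  note R = correspondenceD[OF this]
  obtain S where "correspondence Y Z \<epsilon> S" using assms(2) by (auto simp: GH_close_def)
  note S = correspondenceD[OF this]
  show ?thesis
  proof (rule GH_closeI[of "R O S"])
    fix x z x' z' assume "(x, z) \<in> R O S" "(x', z') \<in> R O S"
    then obtain y y' where "(x, y) \<in> R" "(y, z) \<in> S" "(x', y') \<in> R" "(y', z') \<in> S" by blast
    with R(4)[of x y x' y'] S(4)[of y z y' z']
    show "\<bar>mdist X x x' - mdist Z z z'\<bar> \<le> \<delta> + \<epsilon>" by linarith
  next
    fix z assume "z \<in> mspace Z"
    then obtain y where "(y, z) \<in> S" using S by blast
    then show "\<exists>x. (x, z) \<in> R O S" using R(3)[of y] S(1) by blast
  next
    fix x assume "x \<in> mspace X"
    then obtain y where "(x, y) \<in> R" using R by blast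
    then show "\<exists>z. (x, z) \<in> R O S" using S(2)[of y] R(1) by blast
  qed (use R(1) S(1) in blast)
qed

lemma isometric_imp_GH_close:
  assumes "isometric X Y"
  shows "GH_close X Y 0"
proof -
  obtain f where "isometric_embedding X Y f" "f ` mspace X = mspace Y"
    using assms by (auto simp: isometric_def)
  then show ?thesis
    by (intro GH_closeI[of "{(x, f x) |x. x \<in> mspace X}"]) (auto simp: isometric_embedding_def)
qed

lemma GH_close_finite:
  assumes "finite (mspace X)" "finite (mspace Y)" "mspace X \<noteq> {}" "mspace Y \<noteq> {}"
  shows "\<exists>\<delta>. GH_close X Y \<delta>"
proof -
  let ?P = "(mspace X \<times> mspace X) \<times> mspace Y \<times> mspace Y"
  let ?F = "(\<lambda>((x, x'), y, y'). \<bar>mdist X x x' - mdist Y y y'\<bar>) ` ?P"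
  have "finite ?F" using assms by blast
  then have "\<bar>mdist X x x' - mdist Y y y'\<bar> \<le> Max ?F"
    if "x \<in> mspace X" "x' \<in> mspace X" "y \<in> mspace Y" "y' \<in> mspace Y" for x x' y y'
    using that by (intro Max_ge) force+
  then have "GH_close X Y (Max ?F)"
    by (intro GH_closeI[of "mspace X \<times> mspace Y"]) (use assms in auto)
  then show ?thesis ..
qed

text \<open>A correspondence of distortion at most \<open>2r\<close> glues \<open>X\<close> and \<open>Y\<close> into one metric space in
  which related points are at distance \<open>r\<close>: travel from \<open>x\<close> to a point \<open>a\<close>, jump to a related \<open>b\<close> at
  cost \<open>r\<close>, and continue to \<open>y\<close>. The two jumps of a detour through the other space cost \<open>2r\<close>, which
  pays for the distortion, so the original distances stay shortest. The
  jump cost has to be positive for points of different spaces to be separated.\<close>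

lemma GH_dist_le_of_GH_close:
  fixes X :: "'a metric" and Y :: "'b metric"
  assumes "GH_close X Y (2 * r)" "r > 0"
  shows "GH_dist X Y \<le> ennreal r"
proof (cases "mspace X = {}")
  case True
  then have "mspace Y = {}" using assms(1) by (auto simp: GH_close_def correspondence_def)
  then have "GH_dist X Y \<le> Hausdorff_dist (undefined :: ('a + 'b) metric) {} {}"
    unfolding GH_dist_def using True
    by (intro Inf_lower) (auto simp: isometric_embedding_def intro!: exI[of _ undefined])
  also have "\<dots> \<le> ennreal r"
    unfolding Hausdorff_dist_def using assms(2) by (intro Inf_lower) auto
  finally show ?thesis .
next
  case False
  \<comment> \<open>An infimum over \<open>R\<close> is meaningful only because \<open>X\<close>, hence \<open>R\<close>, is nonempty.\<close>
  obtain R where "correspondence X Y (2 * r) R" using assms(1) by (auto simp: GH_close_def)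
  note R = correspondenceD[OF this]
  have R_ne: "R \<noteq> {}" using R(2) False by blast
  have RX: "a \<in> mspace X" and RY: "b \<in> mspace Y" if "(a, b) \<in> R" for a b
    using that R(1) by auto
  define c where "c x y = (INF (a, b)\<in>R. mdist X x a + r + mdist Y b y)" for x y
  have c_le: "c x y \<le> mdist X x a + r + mdist Y b y" if "(a, b) \<in> R" for x y a b
    unfolding c_def using cINF_lower[OF _ that, of "\<lambda>(a, b). mdist X x a + r + mdist Y b y"] \<open>r > 0\<close>
    by (force intro!: bdd_belowI[of _ 0])
  have c_ge: "z \<le> c x y" if "\<And>a b. (a, b) \<in> R \<Longrightarrow> z \<le> mdist X x a + r + mdist Y b y" for x y z
    unfolding c_def by (rule cINF_greatest[OF R_ne]) (use that in auto)
  have c_pos: "c x y > 0" for x y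
    by (rule less_le_trans[OF \<open>r > 0\<close>], rule c_ge) simp
  have c_X: "c x y \<le> mdist X x x' + c x' y" if "x \<in> mspace X" "x' \<in> mspace X" for x x' y
  proof -
    have "c x y - mdist X x x' \<le> c x' y"
    proof (rule c_ge)
      fix a b assume ab: "(a, b) \<in> R"
      show "c x y - mdist X x x' \<le> mdist X x' a + r + mdist Y b y"
        using c_le[OF ab, of x y] mdist_triangle[OF that RX[OF ab]] by linarith
    qed
    then show ?thesis by linarith
  qed
  have c_Y: "c x y \<le> c x y' + mdist Y y' y" if "y \<in> mspace Y" "y' \<in> mspace Y" for x y y'
  proof -
    have "c x y - mdist Y y' y \<le> c x y'"
    proof (rule c_ge)
      fix a b assume ab: "(a, b) \<in> R"
      show "c x y - mdist Y y' y \<le> mdist X x a + r + mdist Y b y'"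
        using c_le[OF ab, of x y] mdist_triangle[OF RY[OF ab] that(2,1)] by linarith
    qed
    then show ?thesis by linarith
  qed
  have c_X': "c x y \<le> c x' y + mdist X x' x" if "x \<in> mspace X" "x' \<in> mspace X" for x x' y
    using c_X[OF that, of y] by (simp add: mdist_commute)
  have c_Y': "c x y \<le> mdist Y y y' + c x y'" if "y \<in> mspace Y" "y' \<in> mspace Y" for x y y'
    using c_Y[OF that, of x] by (simp add: mdist_commute)
  have X_c: "mdist X x x' \<le> c x y + c x' y"
    if "x \<in> mspace X" "x' \<in> mspace X" "y \<in> mspace Y" for x x' y
  proof -
    have "mdist X x x' - c x' y \<le> c x y"
    proof (rule c_ge)
      fix a b assume ab: "(a, b) \<in> R"
      have "mdist X x x' - (mdist X x a + r + mdist Y b y) \<le> c x' y"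
      proof (rule c_ge)
        fix a' b' assume ab': "(a', b') \<in> R"
        have "mdist X x x' \<le> mdist X x a + (mdist X a a' + mdist X a' x')"
          using mdist_triangle[OF that(1) RX[OF ab] that(2)]
            mdist_triangle[OF RX[OF ab] RX[OF ab'] that(2)] by linarith
        moreover have "mdist Y b b' \<le> mdist Y b y + mdist Y y b'"
          using mdist_triangle[OF RY[OF ab] that(3) RY[OF ab']] .
        ultimately show "mdist X x x' - (mdist X x a + r + mdist Y b y)
            \<le> mdist X x' a' + r + mdist Y b' y"
          using R(4)[OF ab ab'] mdist_commute[of X x' a'] mdist_commute[of Y y b'] by linarith
      qed
      then show "mdist X x x' - c x' y \<le> mdist X x a + r + mdist Y b y" by linarith
    qed
    then show ?thesis by linarith
  qed
  have Y_c: "mdist Y y y' \<le> c x y + c x y'"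
    if "x \<in> mspace X" "y \<in> mspace Y" "y' \<in> mspace Y" for x y y'
  proof -
    have "mdist Y y y' - c x y' \<le> c x y"
    proof (rule c_ge)
      fix a b assume ab: "(a, b) \<in> R"
      have "mdist Y y y' - (mdist X x a + r + mdist Y b y) \<le> c x y'"
      proof (rule c_ge)
        fix a' b' assume ab': "(a', b') \<in> R"
        have "mdist Y y y' \<le> mdist Y y b + (mdist Y b b' + mdist Y b' y')"
          using mdist_triangle[OF that(2) RY[OF ab] that(3)]
            mdist_triangle[OF RY[OF ab] RY[OF ab'] that(3)] by linarith
        moreover have "mdist X a a' \<le> mdist X a x + mdist X x a'"
          using mdist_triangle[OF RX[OF ab] that(1) RX[OF ab']] .
        ultimately show "mdist Y y y' - (mdist X x a + r + mdist Y b y)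
            \<le> mdist X x a' + r + mdist Y b' y'"
          using R(4)[OF ab ab'] mdist_commute[of X x a] mdist_commute[of Y y b] by linarith
      qed
      then show "mdist Y y y' - c x y' \<le> mdist X x a + r + mdist Y b y" by linarith
    qed
    then show ?thesis by linarith
  qed
  define D where "D u v = (case u of
      Inl x \<Rightarrow> (case v of Inl x' \<Rightarrow> mdist X x x' | Inr y \<Rightarrow> c x y)
    | Inr y \<Rightarrow> (case v of Inl x \<Rightarrow> c x y | Inr y' \<Rightarrow> mdist Y y y'))" for u v
  have D_simps [simp]: "D (Inl x) (Inl x') = mdist X x x'" "D (Inl x) (Inr y) = c x y"
    "D (Inr y) (Inl x) = c x y" "D (Inr y) (Inr y') = mdist Y y y'" for x x' y y'
    by (simp_all add: D_def)
  interpret G: Metric_space "mspace X <+> mspace Y" D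
  proof
    fix u v show "0 \<le> D u v" by (cases u; cases v) (auto intro: less_imp_le[OF c_pos])
    show "D u v = D v u" by (cases u; cases v) (auto simp: mdist_commute)
    assume "u \<in> mspace X <+> mspace Y" "v \<in> mspace X <+> mspace Y"
    then show "D u v = 0 \<longleftrightarrow> u = v" using c_pos by (auto simp: less_imp_neq[symmetric])
  next
    fix u v w assume "u \<in> mspace X <+> mspace Y" "v \<in> mspace X <+> mspace Y"
      "w \<in> mspace X <+> mspace Y"
    then show "D u w \<le> D u v + D v w"
      using c_X c_Y X_c Y_c c_X' c_Y' by (auto intro: mdist_triangle)
  qed
  define Z where "Z = metric (mspace X <+> mspace Y, D)"
  have Z [simp]: "mspace Z = mspace X <+> mspace Y" "mdist Z = D"
    by (simp_all add: Z_def)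
  have emb: "isometric_embedding X Z Inl" "isometric_embedding Y Z Inr"
    by (auto simp: isometric_embedding_def)
  have "Hausdorff_dist Z (Inl ` mspace X) (Inr ` mspace Y) \<le> ennreal r'" if "r' > r" for r'
    unfolding Hausdorff_dist_def
  proof (rule Inf_lower, clarify, intro exI[of _ r'] conjI refl)
    have near: "c x y < r'" if "(x, y) \<in> R" for x y
    proof -
      have "mdist X x x = 0" "mdist Y y y = 0" using RX[OF that] RY[OF that] by simp_all
      then show ?thesis using c_le[OF that, of x y] \<open>r' > r\<close> by linarith
    qed
    show "Inl ` mspace X \<subseteq> (\<Union>v\<in>Inr ` mspace Y. mball_of Z v r')"
    proof clarify
      fix x assume "x \<in> mspace X"
      then obtain y where "(x, y) \<in> R" using R(2) by blast
      then show "Inl x \<in> (\<Union>v\<in>Inr ` mspace Y. mball_of Z v r')"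
        using near RX RY by (auto intro!: bexI[of _ y])
    qed
    show "Inr ` mspace Y \<subseteq> (\<Union>u\<in>Inl ` mspace X. mball_of Z u r')"
    proof clarify
      fix y assume "y \<in> mspace Y"
      then obtain x where "(x, y) \<in> R" using R(3) by blast
      then show "Inr y \<in> (\<Union>u\<in>Inl ` mspace X. mball_of Z u r')"
        using near RX RY by (auto intro!: bexI[of _ x])
    qed
    show "r' > 0" using that assms(2) by linarith
  qed
  then have "GH_dist X Y \<le> ennreal r'" if "r' > r" for r'
    unfolding GH_dist_def using emb that by (intro Inf_lower2[OF CollectI]) blast+
  then have le: "GH_dist X Y \<le> ennreal r + ennreal e" if "e > 0" for e
    using that assms(2) by (simp flip: ennreal_plus)
  show ?thesis by (rule ennreal_le_epsilon) (rule le)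
qed

text \<open>Conversely, two isometric copies at Hausdorff distance less than \<open>r\<close> are matched by relating the
  points at distance less than \<open>r\<close>, and the triangle inequality bounds the distortion by \<open>2r\<close>.\<close>

lemma GH_dist_eq_INF:
  fixes X :: "'a metric" and Y :: "'b metric"
  shows "GH_dist X Y = (INF \<delta>\<in>{\<delta>. GH_close X Y \<delta>}. ennreal (\<delta> / 2))"
proof (rule antisym)
  show "GH_dist X Y \<le> (INF \<delta>\<in>{\<delta>. GH_close X Y \<delta>}. ennreal (\<delta> / 2))"
  proof (rule INF_greatest, clarify)
    fix \<delta> assume \<delta>: "GH_close X Y \<delta>"
    have le: "GH_dist X Y \<le> ennreal (\<delta> / 2) + ennreal e" if "e > 0" for e
    proof -
      \<comment> \<open>If both spaces are empty, then \<open>\<delta>\<close> may be negative.\<close>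
      have "GH_close X Y (2 * (max 0 (\<delta> / 2) + e))"
        by (rule GH_close_mono[OF \<delta>]) (use that in simp)
      from GH_dist_le_of_GH_close[OF this] show ?thesis
        using that by (simp add: ennreal_plus add_nonneg_pos max_def ennreal_neg split: if_splits)
    qed
    show "GH_dist X Y \<le> ennreal (\<delta> / 2)" by (rule ennreal_le_epsilon) (rule le)
  qed
  show "(INF \<delta>\<in>{\<delta>. GH_close X Y \<delta>}. ennreal (\<delta> / 2)) \<le> GH_dist X Y"
    unfolding GH_dist_def Hausdorff_dist_def
  proof (intro Inf_greatest, clarify, intro Inf_greatest, clarify)
    fix Z :: "('a + 'b) metric" and f g r
    assume f: "isometric_embedding X Z f" and g: "isometric_embedding Y Z g"
      and r: "0 < (r :: real)"
      and sub: "f ` mspace X \<subseteq> (\<Union>b\<in>g ` mspace Y. mball_of Z b r)"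
      "g ` mspace Y \<subseteq> (\<Union>a\<in>f ` mspace X. mball_of Z a r)"
    have fZ: "f x \<in> mspace Z" if "x \<in> mspace X" for x
      using f that by (auto simp: isometric_embedding_def)
    have gZ: "g y \<in> mspace Z" if "y \<in> mspace Y" for y
      using g that by (auto simp: isometric_embedding_def)
    let ?R = "{(x, y). x \<in> mspace X \<and> y \<in> mspace Y \<and> mdist Z (f x) (g y) < r}"
    have "GH_close X Y (2 * r)"
    proof (rule GH_closeI[of ?R])
      fix x y x' y' assume R: "(x, y) \<in> ?R" "(x', y') \<in> ?R"
      have "mdist X x x' = mdist Z (f x) (f x')" "mdist Y y y' = mdist Z (g y) (g y')"
        using f g R by (simp_all add: isometric_embedding_def)
      moreover have "mdist Z (f x) (f x') \<le> mdist Z (f x) (g y) + mdist Z (g y) (f x')"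
        "mdist Z (g y) (f x') \<le> mdist Z (g y) (g y') + mdist Z (g y') (f x')"
        "mdist Z (g y) (g y') \<le> mdist Z (g y) (f x) + mdist Z (f x) (g y')"
        "mdist Z (f x) (g y') \<le> mdist Z (f x) (f x') + mdist Z (f x') (g y')"
        using R by (auto intro!: mdist_triangle fZ gZ)
      moreover have "mdist Z (f x) (g y) < r" "mdist Z (f x') (g y') < r"
        "mdist Z (g y) (f x) < r" "mdist Z (g y') (f x') < r"
        using R by (auto simp: mdist_commute)
      ultimately show "\<bar>mdist X x x' - mdist Y y y'\<bar> \<le> 2 * r" by linarith
    next
      fix x assume "x \<in> mspace X"
      then obtain y where "y \<in> mspace Y" "f x \<in> mball_of Z (g y) r" using sub(1) by blast
      then show "\<exists>y. (x, y) \<in> ?R" using \<open>x \<in> mspace X\<close> by (auto simp: mdist_commute)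
    next
      fix y assume "y \<in> mspace Y"
      then obtain x where "x \<in> mspace X" "g y \<in> mball_of Z (f x) r" using sub(2) by blast
      then show "\<exists>x. (x, y) \<in> ?R" using \<open>y \<in> mspace Y\<close> by auto
    qed auto
    then show "(INF \<delta>\<in>{\<delta>. GH_close X Y \<delta>}. ennreal (\<delta> / 2)) \<le> ennreal r"
      by (intro INF_lower2[of "2 * r"]) auto
  qed
qed

lemma GH_dist_commute: "GH_dist X Y = GH_dist Y X"
proof -
  have "GH_close X Y = GH_close Y X"
    by (intro ext iffI) (erule GH_close_sym)+
  then show ?thesis by (simp only: GH_dist_eq_INF)
qed

lemma GH_dist_finite:
  assumes "finite (mspace X)" "finite (mspace Y)" "mspace X \<noteq> {}" "mspace Y \<noteq> {}"
  shows "GH_dist X Y < top"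
proof -
  obtain \<delta> where "GH_close X Y \<delta>" using GH_close_finite[OF assms] ..
  then have "GH_dist X Y \<le> ennreal (\<delta> / 2)"
    unfolding GH_dist_eq_INF by (intro INF_lower) simp
  then show ?thesis using ennreal_less_top by (rule le_less_trans)
qed

lemma GH_close_imp_enn2real_le:
  assumes "GH_close X Y \<delta>" "mspace X \<noteq> {}"
  shows "enn2real (GH_dist X Y) \<le> \<delta> / 2"
proof (rule enn2real_leI)
  show "\<delta> / 2 \<ge> 0" using GH_close_nonneg[OF assms] by simp
  show "GH_dist X Y \<le> ennreal (\<delta> / 2)"
    unfolding GH_dist_eq_INF by (intro INF_lower) (simp add: assms(1))
qed

lemma enn2real_less_imp_GH_close:
  assumes "finite (mspace X)" "finite (mspace Y)" "mspace X \<noteq> {}" "mspace Y \<noteq> {}"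
    and "enn2real (GH_dist X Y) < r"
  shows "GH_close X Y (2 * r)"
proof -
  have "GH_dist X Y = ennreal (enn2real (GH_dist X Y))"
    using GH_dist_finite[OF assms(1-4)] by simp
  also have "\<dots> < ennreal r"
    using assms(5) by (intro ennreal_lessI) (auto intro: le_less_trans[OF enn2real_nonneg])
  finally obtain \<delta> where \<delta>: "GH_close X Y \<delta>" "ennreal (\<delta> / 2) < ennreal r"
    unfolding GH_dist_eq_INF by (auto simp: INF_less_iff)
  have "\<delta> / 2 < r" using \<delta>(2) by (meson ennreal_leI leD le_less_linear)
  then show ?thesis by (intro GH_close_mono[OF \<delta>(1)]) simp
qed

section \<open>The space of four-point metric spaces\<close>

text \<open>Two points related to the same point of \<open>Y\<close> are at distance at most the distortion, so below the
  smallest distance of \<open>X\<close> every choice function of the correspondence is injective.\<close>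

lemma GH_close_bijection:
  assumes "GH_close X Y \<delta>" "finite (mspace X)" "finite (mspace Y)"
    and "card (mspace X) = card (mspace Y)"
    and sep: "\<And>x x'. x \<in> mspace X \<Longrightarrow> x' \<in> mspace X \<Longrightarrow> x \<noteq> x' \<Longrightarrow> \<delta> < mdist X x x'"
  shows "\<exists>f. bij_betw f (mspace X) (mspace Y) \<and>
    (\<forall>x\<in>mspace X. \<forall>x'\<in>mspace X. \<bar>mdist X x x' - mdist Y (f x) (f x')\<bar> \<le> \<delta>)"
proof -
  obtain R where "correspondence X Y \<delta> R" using assms(1) by (auto simp: GH_close_def)
  note R = correspondenceD[OF this]
  obtain f where f: "\<And>x. x \<in> mspace X \<Longrightarrow> (x, f x) \<in> R" using R(2) by metis
  have "inj_on f (mspace X)"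
  proof (rule inj_onI, rule ccontr)
    fix x x' assume x: "x \<in> mspace X" "x' \<in> mspace X" "f x = f x'" "x \<noteq> x'"
    have "f x' \<in> mspace Y" using f[OF x(2)] R(1) by blast
    then have "mdist Y (f x) (f x') = 0" using x(3) by simp
    then show False using R(4)[OF f f, OF x(1,2)] sep[OF x(1,2,4)] by linarith
  qed
  moreover have "f ` mspace X \<subseteq> mspace Y" using f R(1) by blast
  ultimately have "bij_betw f (mspace X) (mspace Y)"
    using assms(3,4) by (simp add: bij_betw_def card_image card_subset_eq)
  then show ?thesis using R(4)[OF f f] by blast
qed

text \<open>Serves to choose distortions smaller than all the finitely many relevant positive
  quantities, without having to know which of them are positive.\<close>

lemma finite_positive_lower_bound:
  fixes S :: "real set"
  assumes "finite S"
  shows "\<exists>\<epsilon>>0. \<forall>s\<in>S. s > 0 \<longrightarrow> \<epsilon> < s"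
proof -
  let ?S = "insert 1 {s \<in> S. s > 0}"
  have fin: "finite ?S" using assms by simp
  have pos: "Min ?S > 0" using Min_in[OF fin] by auto
  have "Min ?S / 2 < s" if "s \<in> S" "s > 0" for s
    using Min_le[OF fin, of s] pos that by simp
  then show ?thesis using pos by (intro exI[of _ "Min ?S / 2"]) simp
qed

text \<open>The deviations \<open>\<bar>mdist X x x' - mdist Y y y'\<bar>\<close> take finitely many values, so a bijection whose
  deviations are below the least positive value is an isometry.\<close>

lemma isometric_if_all_GH_close:
  assumes "finite (mspace X)" "finite (mspace Y)" "card (mspace X) = card (mspace Y)"
    and close: "\<And>\<delta>. \<delta> > 0 \<Longrightarrow> GH_close X Y \<delta>"
  shows "isometric X Y"
proof -
  define S where "S = (\<lambda>(x, x'). mdist X x x') ` (mspace X \<times> mspace X) \<union>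
    (\<lambda>((x, x'), y, y'). \<bar>mdist X x x' - mdist Y y y'\<bar>) `
      ((mspace X \<times> mspace X) \<times> mspace Y \<times> mspace Y)"
  have S1: "mdist X x x' \<in> S" if "x \<in> mspace X" "x' \<in> mspace X" for x x'
    using that by (force simp: S_def)
  have S2: "\<bar>mdist X x x' - mdist Y y y'\<bar> \<in> S"
    if "x \<in> mspace X" "x' \<in> mspace X" "y \<in> mspace Y" "y' \<in> mspace Y" for x x' y y'
    using that by (force simp: S_def)
  have "finite S" using assms(1,2) by (simp add: S_def)
  from finite_positive_lower_bound[OF this]
  obtain \<epsilon> where \<epsilon>: "\<epsilon> > 0" "\<forall>s\<in>S. s > 0 \<longrightarrow> \<epsilon> < s" by blast
  have "\<epsilon> < mdist X x x'" if "x \<in> mspace X" "x' \<in> mspace X" "x \<noteq> x'" for x x'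
    using bspec[OF \<epsilon>(2) S1[OF that(1,2)]] that by (simp add: order_less_le)
  from GH_close_bijection[OF close[OF \<epsilon>(1)] assms(1-3) this]
  obtain f where f: "bij_betw f (mspace X) (mspace Y)"
    "\<forall>x\<in>mspace X. \<forall>x'\<in>mspace X. \<bar>mdist X x x' - mdist Y (f x) (f x')\<bar> \<le> \<epsilon>"
    by blast
  have "mdist Y (f x) (f x') = mdist X x x'" if "x \<in> mspace X" "x' \<in> mspace X" for x x'
  proof -
    have "f x \<in> mspace Y" "f x' \<in> mspace Y" using bij_betwE[OF f(1)] that by auto
    from bspec[OF \<epsilon>(2) S2[OF that this]] show ?thesis using f(2) that by fastforce
  qed
  then show ?thesis
    unfolding isometric_def isometric_embedding_def
    using f(1) by (intro exI[of _ f]) (auto simp: bij_betw_def)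
qed

lemma isometric_card_eq: "isometric X Y \<Longrightarrow> card (mspace X) = card (mspace Y)"
  unfolding isometric_def using card_image[OF isometric_embedding_inj_on] by fastforce

lemma four_point_space_iff:
  "A \<in> four_point_space \<longleftrightarrow> (\<exists>X. A = isometry_rel `` {X} \<and> card (mspace X) = 4)"
  unfolding four_point_space_def quotient_def by blast

lemma card_eq_4_imp:
  assumes "card M = 4"
  shows "finite M" "M \<noteq> {}"
  using assms card.infinite by fastforce+

lemma Metric_space_four_point: "Metric_space four_point_space class_dist"
proof
  fix A B
  show "0 \<le> class_dist A B" by (simp add: class_dist_def)
next
  fix A B
  show "class_dist A B = class_dist B A" unfolding class_dist_def by (subst GH_dist_commute) rule
next
  fix A B assume "A \<in> four_point_space" "B \<in> four_point_space"
  then obtain X Y where X: "A = isometry_rel `` {X}" "card (mspace X) = 4"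
    and Y: "B = isometry_rel `` {Y}" "card (mspace Y) = 4"
    by (auto simp: four_point_space_iff)
  note fin = card_eq_4_imp[OF X(2)] card_eq_4_imp[OF Y(2)]
  have "GH_close X Y \<delta>" if "class_dist A B = 0" "\<delta> > 0" for \<delta>
    using enn2real_less_imp_GH_close[OF fin(1,3,2,4), of "\<delta> / 2"] that
    by (simp add: X Y class_dist_eq)
  then have "isometric X Y" if "class_dist A B = 0"
    using isometric_if_all_GH_close[OF fin(1,3)] X(2) Y(2) that by simp
  moreover have "class_dist A B = 0" if "isometric X Y"
    using GH_close_imp_enn2real_le[OF isometric_imp_GH_close[OF that] fin(2)]
      enn2real_nonneg[of "GH_dist X Y"] by (simp add: X Y class_dist_eq)
  moreover have "isometric X Y \<longleftrightarrow> A = B"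
    using equiv_isometry_rel by (simp add: X Y eq_equiv_class_iff) (simp add: isometry_rel_def)
  ultimately show "class_dist A B = 0 \<longleftrightarrow> A = B" by blast
next
  fix A B C assume "A \<in> four_point_space" "B \<in> four_point_space" "C \<in> four_point_space"
  then obtain X Y Z where X: "A = isometry_rel `` {X}" "card (mspace X) = 4"
    and Y: "B = isometry_rel `` {Y}" "card (mspace Y) = 4"
    and Z: "C = isometry_rel `` {Z}" "card (mspace Z) = 4"
    by (auto simp: four_point_space_iff)
  note X' = card_eq_4_imp[OF X(2)] and Y' = card_eq_4_imp[OF Y(2)] and Z' = card_eq_4_imp[OF Z(2)]
  show "class_dist A C \<le> class_dist A B + class_dist B C"
  proof (rule field_le_epsilon)
    fix e :: real assume "e > 0"
    have "GH_close X Y (2 * (class_dist A B + e / 2))"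
      by (rule enn2real_less_imp_GH_close[OF X'(1) Y'(1) X'(2) Y'(2)])
         (use \<open>e > 0\<close> in \<open>simp add: X Y class_dist_eq\<close>)
    moreover have "GH_close Y Z (2 * (class_dist B C + e / 2))"
      by (rule enn2real_less_imp_GH_close[OF Y'(1) Z'(1) Y'(2) Z'(2)])
         (use \<open>e > 0\<close> in \<open>simp add: Y Z class_dist_eq\<close>)
    ultimately have "class_dist A C
        \<le> (2 * (class_dist A B + e / 2) + 2 * (class_dist B C + e / 2)) / 2"
      using GH_close_imp_enn2real_le[OF GH_close_trans X'(2)]
      by (simp only: X Z class_dist_eq)
    then show "class_dist A C \<le> class_dist A B + class_dist B C + e" by (simp add: field_simps)
  qed
qed

section \<open>Skew quadruples\<close>

text \<open>The two shortest edges are disjoint, and the next shortest edge \<open>pr\<close> and the longest edge \<open>qs\<close> are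
  disjoint as well; this is one of several possible positions of the longest edge, fixed in
  order to have one chain of inequalities. The bound by \<open>2 * mdist X p q\<close> makes the triangle inequality
  automatic, so that single distances can be varied freely.\<close>

definition skew_quadruple :: "'a metric \<Rightarrow> 'a \<Rightarrow> 'a \<Rightarrow> 'a \<Rightarrow> 'a \<Rightarrow> bool" where
  "skew_quadruple X p q r s \<longleftrightarrow> mspace X = {p, q, r, s} \<and> distinct [p, q, r, s] \<and>
     mdist X p q < mdist X r s \<and> mdist X r s < mdist X p r \<and> mdist X p r < mdist X p s \<and>
     mdist X p s < mdist X q r \<and> mdist X q r < mdist X q s \<and> mdist X q s < 2 * mdist X p q"

lemma skew_quadruple_realization:
  fixes a b c e e' f :: real
  assumes "a < b" "b < c" "c < e" "e < e'" "e' < f" "f < 2 * a"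
  shows "\<exists>X :: nat metric. skew_quadruple X 0 1 2 3 \<and> mdist X 0 1 = a \<and> mdist X 2 3 = b \<and>
    mdist X 0 2 = c \<and> mdist X 0 3 = e \<and> mdist X 1 2 = e' \<and> mdist X 1 3 = f"
proof -
  define d :: "nat \<Rightarrow> nat \<Rightarrow> real" where "d i j = (if i = j then 0 else if {i, j} = {0, 1} then a
    else if {i, j} = {2, 3} then b else if {i, j} = {0, 2} then c else if {i, j} = {0, 3} then e
    else if {i, j} = {1, 2} then e' else f)" for i j
  have comm: "d i j = d j i" for i j
    by (simp add: d_def insert_commute)
  have bounds: "a \<le> d i j \<and> d i j \<le> 2 * a" if "i \<noteq> j" for i j
    using that assms by (simp add: d_def)
  have diag: "d i i = 0" for i by (simp add: d_def)
  interpret Metric_space "{0, 1, 2, 3}" d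
  proof
    fix i j :: nat
    show "0 \<le> d i j" using bounds[of i j] diag[of i] assms by (cases "i = j") auto
    show "d i j = d j i" by (rule comm)
    show "d i j = 0 \<longleftrightarrow> i = j" using bounds[of i j] diag[of i] assms by (cases "i = j") auto
  next
    fix i j k :: nat
    show "d i k \<le> d i j + d j k"
      using bounds[of i j] bounds[of j k] bounds[of i k] diag[of i] diag[of j] diag[of k] assms
      by (cases "i = j"; cases "j = k"; cases "i = k") auto
  qed
  let ?X = "metric ({0, 1, 2, 3}, d)"
  have "d 0 1 = a" "d 2 3 = b" "d 0 2 = c" "d 0 3 = e" "d 1 2 = e'" "d 1 3 = f"
    by (simp_all add: d_def doubleton_eq_iff)
  then show ?thesis
    unfolding skew_quadruple_def using assms
    by (intro exI[of _ ?X]) (simp del: One_nat_def)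
qed

text \<open>If distances change by at most \<open>\<epsilon>\<close> then a gap between two of them survives when it
  exceeds \<open>2\<epsilon>\<close>, and the gap between \<open>qs\<close> and twice \<open>pq\<close> when it exceeds \<open>3\<epsilon>\<close>; this explains the
  denominators.\<close>

lemma skew_quadruple_stable:
  assumes "skew_quadruple X p q r s"
  shows "\<exists>\<epsilon>>0. \<forall>Y. card (mspace Y) = 4 \<longrightarrow> GH_close X Y \<epsilon> \<longrightarrow>
    (\<exists>p' q' r' s'. skew_quadruple Y p' q' r' s')"
proof -
  define gaps where "gaps = {(mdist X r s - mdist X p q) / 2, (mdist X p r - mdist X r s) / 2,
    (mdist X p s - mdist X p r) / 2, (mdist X q r - mdist X p s) / 2,
    (mdist X q s - mdist X q r) / 2, (2 * mdist X p q - mdist X q s) / 3}"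
  have X: "mspace X = {p, q, r, s}" "distinct [p, q, r, s]"
    and chain: "mdist X p q < mdist X r s" "mdist X r s < mdist X p r" "mdist X p r < mdist X p s"
     "mdist X p s < mdist X q r" "mdist X q r < mdist X q s" "mdist X q s < 2 * mdist X p q"
    using assms by (auto simp: skew_quadruple_def)
  have "finite gaps" by (simp add: gaps_def)
  from finite_positive_lower_bound[OF this]
  obtain \<epsilon> where "\<epsilon> > 0" and \<epsilon>: "\<forall>g\<in>gaps. g > 0 \<longrightarrow> \<epsilon> < g" by blast
  have gap: "2 * \<epsilon> < mdist X r s - mdist X p q" "2 * \<epsilon> < mdist X p r - mdist X r s"
    "2 * \<epsilon> < mdist X p s - mdist X p r" "2 * \<epsilon> < mdist X q r - mdist X p s"
    "2 * \<epsilon> < mdist X q s - mdist X q r" "3 * \<epsilon> < 2 * mdist X p q - mdist X q s"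
    using \<epsilon> chain by (simp_all add: gaps_def field_simps)
  have "\<exists>p' q' r' s'. skew_quadruple Y p' q' r' s'"
    if Y: "card (mspace Y) = 4" and close: "GH_close X Y \<epsilon>" for Y :: "'b metric"
  proof -
    have card: "card (mspace X) = card (mspace Y)" using X Y by simp
    \<comment> \<open>The last gap is below \<open>mdist X p q\<close>, so \<open>\<epsilon>\<close> is less than every distance.\<close>
    have sep: "\<epsilon> < mdist X x x'" if "x \<in> mspace X" "x' \<in> mspace X" "x \<noteq> x'" for x x'
      using that gap chain \<open>\<epsilon> > 0\<close> unfolding X(1)
      by (elim insertE emptyE) (simp_all add: mdist_commute)
    have "finite (mspace X)" using X by simp
    from GH_close_bijection[OF close this card_eq_4_imp(1)[OF Y] card sep]
    obtain h where h: "bij_betw h (mspace X) (mspace Y)"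
      "\<forall>x\<in>mspace X. \<forall>x'\<in>mspace X. \<bar>mdist X x x' - mdist Y (h x) (h x')\<bar> \<le> \<epsilon>" by blast
    have "mspace Y = {h p, h q, h r, h s}" using h(1) X(1) by (simp add: bij_betw_def)
    moreover have "distinct [h p, h q, h r, h s]"
      using h(1) X by (auto simp: bij_betw_def inj_on_def)
    moreover have
      "\<bar>mdist X p q - mdist Y (h p) (h q)\<bar> \<le> \<epsilon>" "\<bar>mdist X r s - mdist Y (h r) (h s)\<bar> \<le> \<epsilon>"
      "\<bar>mdist X p r - mdist Y (h p) (h r)\<bar> \<le> \<epsilon>" "\<bar>mdist X p s - mdist Y (h p) (h s)\<bar> \<le> \<epsilon>"
      "\<bar>mdist X q r - mdist Y (h q) (h r)\<bar> \<le> \<epsilon>" "\<bar>mdist X q s - mdist Y (h q) (h s)\<bar> \<le> \<epsilon>"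
      using h(2) X(1) by simp_all
    ultimately have "skew_quadruple Y (h p) (h q) (h r) (h s)"
      unfolding skew_quadruple_def using gap by auto
    then show ?thesis by blast
  qed
  with \<open>\<epsilon> > 0\<close> show ?thesis by blast
qed

text \<open>Each bound has its own reason. Necessity: some pair realizing the diameter is either in one label
  class or in two, whence \<open>f - t \<le> \<delta>\<close>. With few labels the pigeonhole principle puts an edge
  inside a class. With many labels some edge of a given family joins two classes, since otherwise
  its edges would identify too many labels: the path \<open>q p r s\<close> of edges of length at most \<open>c\<close>
  leaves one label, the edges \<open>pq\<close> and \<open>rs\<close> leave two, the edge \<open>pq\<close> leaves three. With more than four labels one point has to carry
  two of them, which costs \<open>t\<close>. Sufficiency: the partitions \<open>{p, q}, {r, s}\<close> and \<open>{p, q}, {r}, {s}\<close>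
  attain the bounds for two and three labels, and surplus labels are all attached to \<open>p\<close>.\<close>

lemma GH_close_Delta_iff:
  fixes X :: "'a metric"
  assumes X: "mspace X = {p, q, r, s}" and "mdist X p q = a" "mdist X r s = b" "mdist X p r = c"
    and "mdist X q s = f" "a \<le> b" "b \<le> c"
    and cross: "c \<le> mdist X p s" "c \<le> mdist X q r" "mdist X p s \<le> f" "mdist X q r \<le> f" "c \<le> f"
    and "t > 0" "m \<ge> 1"
  shows "GH_close X (Delta t m) \<delta> \<longleftrightarrow> f - t \<le> \<delta> \<and>
    (m = 1 \<longrightarrow> f \<le> \<delta>) \<and> (m = 2 \<longrightarrow> b \<le> \<delta>) \<and> (m = 3 \<longrightarrow> a \<le> \<delta>) \<and>
    (m \<ge> 2 \<longrightarrow> t - c \<le> \<delta>) \<and> (m \<ge> 3 \<longrightarrow> t - b \<le> \<delta>) \<and> (m \<ge> 4 \<longrightarrow> t - a \<le> \<delta>) \<and>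
    (m \<ge> 5 \<longrightarrow> t \<le> \<delta>)"
    (is "_ \<longleftrightarrow> ?bounds")
proof
  note [simp] = assms(2-5) mspace_Delta[OF \<open>t > 0\<close>] mdist_Delta[OF \<open>t > 0\<close>]
  have diag: "mdist X x x = 0" if "x \<in> mspace X" for x using that by simp
  {
    assume "GH_close X (Delta t m) \<delta>"
    then obtain R where "correspondence X (Delta t m) \<delta> R" by (auto simp: GH_close_def)
    note R = correspondenceD[OF this]
    \<comment> \<open>All that the correspondence tells about pairs with equal and with different labels.\<close>
    have same: "mdist X x y \<le> \<delta>" if "(x, i) \<in> R" "(y, i) \<in> R" for x y i
      using R(4)[OF that] by simp
    have diff: "mdist X x y - t \<le> \<delta>" "t - mdist X x y \<le> \<delta>"
      if "(x, i) \<in> R" "(y, j) \<in> R" "i \<noteq> j" for x y i j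
      using R(4)[OF that(1,2)] that(3) by auto
    have lab: "i < m" if "(x, i) \<in> R" for x i using R(1) that by auto
    have hit: "(p, k) \<in> R \<or> (q, k) \<in> R \<or> (r, k) \<in> R \<or> (s, k) \<in> R" if k: "k < m" for k
    proof -
      obtain x where "(x, k) \<in> R" using R(3)[of k] k by auto
      then show ?thesis using R(1) X by auto
    qed
    obtain kp kq kr ks where i: "(p, kp) \<in> R" "(q, kq) \<in> R" "(r, kr) \<in> R" "(s, ks) \<in> R"
      using R(2)[of p] R(2)[of q] R(2)[of r] R(2)[of s] X by auto
    note lt = lab[OF i(1)] lab[OF i(2)] lab[OF i(3)] lab[OF i(4)]
    have "f - t \<le> \<delta>"
      using same[of q kq s] diff(1)[OF i(2,4)] i \<open>t > 0\<close> by (cases "kq = ks") auto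
    moreover have "f \<le> \<delta>" if "m = 1"
      using same[of q kq s] i lt that by simp
    moreover have "b \<le> \<delta>" if "m = 2"
    proof -
      \<comment> \<open>Either \<open>rs\<close> lies in one class, or one of the edges \<open>pr\<close>, \<open>ps\<close> does; none is shorter than \<open>b\<close>.\<close>
      have "kr = ks \<or> kr = kp \<or> ks = kp" using lt that by linarith
      then show ?thesis
        using same[OF i(3), of s] same[OF i(1), of r] same[OF i(1), of s] i assms(6,7) cross by auto
    qed
    moreover have "a \<le> \<delta>" if "m = 3"
    proof -
      have "kp = kq \<or> kp = kr \<or> kp = ks \<or> kq = kr \<or> kq = ks \<or> kr = ks"
        using lt that by linarith
      then show ?thesis
        using same[OF i(1), of q] same[OF i(1), of r] same[OF i(1), of s] same[OF i(2), of r]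
          same[OF i(2), of s] same[OF i(3), of s] i assms(6,7) cross by auto
    qed
    moreover have "t - c \<le> \<delta>" if "m \<ge> 2"
    proof (rule ccontr)
      assume "\<not> t - c \<le> \<delta>"
      then have *: "\<not> t - a \<le> \<delta>" "\<not> t - b \<le> \<delta>" "\<not> t - c \<le> \<delta>" using assms(6,7) by auto
      have pq: "i = j" if "(p, i) \<in> R" "(q, j) \<in> R" for i j
        using diff(2)[of p i q j] that * by auto
      have pr: "i = j" if "(p, i) \<in> R" "(r, j) \<in> R" for i j
        using diff(2)[of p i r j] that * by auto
      have rs: "i = j" if "(r, i) \<in> R" "(s, j) \<in> R" for i j
        using diff(2)[of r i s j] that * by auto
      have "(p, k) \<in> R \<or> (q, k) \<in> R \<or> (r, k) \<in> R \<or> (s, k) \<in> R \<Longrightarrow> k = kp" for k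
        using i pq pr rs by metis
      then have "k = kp" if "k < m" for k using hit[OF that] by blast
      from this[of 0] this[of 1] show False using that by linarith
    qed
    moreover have "t - b \<le> \<delta>" if "m \<ge> 3"
    proof (rule ccontr)
      assume "\<not> t - b \<le> \<delta>"
      then have *: "\<not> t - a \<le> \<delta>" "\<not> t - b \<le> \<delta>" using assms(6) by auto
      have pq: "i = j" if "(p, i) \<in> R" "(q, j) \<in> R" for i j
        using diff(2)[of p i q j] that * by auto
      have rs: "i = j" if "(r, i) \<in> R" "(s, j) \<in> R" for i j
        using diff(2)[of r i s j] that * by auto
      have "(p, k) \<in> R \<or> (q, k) \<in> R \<or> (r, k) \<in> R \<or> (s, k) \<in> R \<Longrightarrow> k = kp \<or> k = kr" for k
        using i pq rs by metis
      then have "k = kp \<or> k = kr" if "k < m" for k using hit[OF that] by blast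
      from this[of 0] this[of 1] this[of 2] show False using that by linarith
    qed
    \<comment> \<open>A point with two labels is a pair at distance zero with different labels.\<close>
    moreover have unique: "i = j" if "t > \<delta>" "(x, i) \<in> R" "(x, j) \<in> R" for x i j
    proof -
      have "x \<in> mspace X" using R(1) that(2) by blast
      then show ?thesis using diff(2)[OF that(2,3)] diag[of x] that(1) by linarith
    qed
    have "t - a \<le> \<delta>" if "m \<ge> 4"
    proof (rule ccontr)
      assume *: "\<not> t - a \<le> \<delta>"
      then have pq: "i = j" if "(p, i) \<in> R" "(q, j) \<in> R" for i j
        using diff(2)[of p i q j] that by auto
      have "t > \<delta>" using * mdist_nonneg[of X p q] by simp
      have "(p, k) \<in> R \<or> (q, k) \<in> R \<or> (r, k) \<in> R \<or> (s, k) \<in> R \<Longrightarrow> k = kp \<or> k = kr \<or> k = ks" for k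
        using i pq unique[OF \<open>t > \<delta>\<close>] by metis
      then have "k = kp \<or> k = kr \<or> k = ks" if "k < m" for k using hit[OF that] by blast
      from this[of 0] this[of 1] this[of 2] this[of 3] show False using that by linarith
    qed
    moreover have "t \<le> \<delta>" if "m \<ge> 5"
    proof (rule ccontr)
      assume "\<not> t \<le> \<delta>"
      then have "t > \<delta>" by simp
      have "(p, k) \<in> R \<or> (q, k) \<in> R \<or> (r, k) \<in> R \<or> (s, k) \<in> R
          \<Longrightarrow> k = kp \<or> k = kq \<or> k = kr \<or> k = ks" for k
        using i unique[OF \<open>t > \<delta>\<close>] by metis
      then have "k = kp \<or> k = kq \<or> k = kr \<or> k = ks" if "k < m" for k using hit[OF that] by blast
      from this[of 0] this[of 1] this[of 2] this[of 3] this[of 4] show False using that by linarith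
    qed
    ultimately show ?bounds by blast
  }
  assume B: ?bounds
  have nonneg: "0 \<le> a" using mdist_nonneg[of X p q] by simp
  have diag': "mdist X p p = 0" "mdist X q q = 0" "mdist X r r = 0" "mdist X s s = 0"
    using diag by (simp_all add: X)
  note comm = mdist_commute[of X q p] mdist_commute[of X r p] mdist_commute[of X s p]
    mdist_commute[of X r q] mdist_commute[of X s q] mdist_commute[of X s r]
  have far: "mdist X x y - t \<le> \<delta>" if "x \<in> mspace X" "y \<in> mspace X" for x y
  proof -
    have "mdist X x y \<in> {0, a, b, c, mdist X p s, mdist X q r, f}"
      using that diag' comm by (auto simp: X)
    then have "mdist X x y \<le> f" using nonneg assms(6,7) cross by auto
    then show ?thesis using B by linarith
  qed
  have close: "GH_close X (Delta t m) \<delta>"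
    if R: "R \<subseteq> mspace X \<times> {..<m}" "\<And>x. x \<in> mspace X \<Longrightarrow> \<exists>i. (x, i) \<in> R"
      "\<And>i. i < m \<Longrightarrow> \<exists>x. (x, i) \<in> R"
      and same: "\<And>x y i. (x, i) \<in> R \<Longrightarrow> (y, i) \<in> R \<Longrightarrow> mdist X x y \<le> \<delta>"
      and diff: "\<And>x y i j. (x, i) \<in> R \<Longrightarrow> (y, j) \<in> R \<Longrightarrow> i < j \<Longrightarrow> t - mdist X x y \<le> \<delta>" for R
  proof (rule GH_closeI[of R])
    fix x y i j assume xy: "(x, i) \<in> R" "(y, j) \<in> R"
    have "mdist X x y - t \<le> \<delta>" using far xy R(1) by blast
    moreover have "t - mdist X x y \<le> \<delta>" if "i \<noteq> j"
      using diff[OF xy] diff[OF xy(2,1)] that by (cases "i < j") (simp_all add: mdist_commute)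
    ultimately show "\<bar>mdist X x y - mdist (Delta t m) i j\<bar> \<le> \<delta>"
      using same[of x i y] xy by auto
  qed (use R in auto)
  consider "m = 1" | "m = 2" | "m = 3" | "m \<ge> 4" using \<open>m \<ge> 1\<close> by linarith
  then show "GH_close X (Delta t m) \<delta>"
  proof cases
    case 1
    have le: "f \<le> \<delta>" using 1 B by simp
    show ?thesis
    proof (rule close[of "{p, q, r, s} \<times> {0}"])
      fix x y i assume "(x, i) \<in> {p, q, r, s} \<times> {0 :: nat}" "(y, i) \<in> {p, q, r, s} \<times> {0 :: nat}"
      then have "mdist X x y \<in> {0, a, b, c, mdist X p s, mdist X q r, f}"
        using diag' comm by auto
      then show "mdist X x y \<le> \<delta>" using le nonneg assms(6,7) cross by auto
    qed (auto simp: X 1)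
  next
    case 2
    have le: "b \<le> \<delta>" "t - c \<le> \<delta>" using 2 B by simp_all
    have ge: "a \<le> \<delta>" "0 \<le> \<delta>" "t - mdist X p s \<le> \<delta>" "t - mdist X q r \<le> \<delta>" "t - f \<le> \<delta>"
      using le nonneg assms(6,7) cross by linarith+
    show ?thesis
    proof (rule close[of "{(p, 0), (q, 0), (r, 1), (s, 1)}"])
      fix i assume "i < m"
      then have "i = 0 \<or> i = 1" using 2 by linarith
      then show "\<exists>x. (x, i) \<in> {(p, 0), (q, 0), (r, 1), (s, 1)}" by auto
    qed (use le ge comm in \<open>auto simp: X 2 diag'\<close>)
  next
    case 3
    have le: "a \<le> \<delta>" "t - b \<le> \<delta>" using 3 B by simp_all
    have ge: "0 \<le> \<delta>" "t - c \<le> \<delta>" "t - mdist X p s \<le> \<delta>" "t - mdist X q r \<le> \<delta>" "t - f \<le> \<delta>"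
      using le nonneg assms(6,7) cross by linarith+
    show ?thesis
    proof (rule close[of "{(p, 0), (q, 0), (r, 1), (s, 2)}"])
      fix i assume "i < m"
      then have "i = 0 \<or> i = 1 \<or> i = 2" using 3 by linarith
      then show "\<exists>x. (x, i) \<in> {(p, 0), (q, 0), (r, 1), (s, 2)}" by auto
    qed (use le ge comm in \<open>auto simp: X 3 diag'\<close>)
  next
    case 4
    have le: "t - a \<le> \<delta>" "f - t \<le> \<delta>" using 4 B by simp_all
    have ge: "0 \<le> \<delta>" "t - b \<le> \<delta>" "t - c \<le> \<delta>" "t - mdist X p s \<le> \<delta>" "t - mdist X q r \<le> \<delta>"
      "t - f \<le> \<delta>"
      using le assms(6,7) cross by linarith+
    have extra: "t \<le> \<delta>" if "4 \<le> i" "i < m" for i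
      using B that by linarith
    let ?R = "{(p, 0), (q, 1), (r, 2), (s, 3)} \<union> {p} \<times> {4..<m}"
    show ?thesis
    proof (rule close[of ?R])
      fix i assume "i < m"
      then have "i = 0 \<or> i = 1 \<or> i = 2 \<or> i = 3 \<or> i \<in> {4..<m}" by auto
      then show "\<exists>x. (x, i) \<in> ?R" by blast
    next
      fix x y i assume "(x, i) \<in> ?R" "(y, i) \<in> ?R"
      then have "x = y" "x \<in> mspace X" by (auto simp: X)
      then show "mdist X x y \<le> \<delta>" using diag[of x] ge(1) by metis
    next
      fix x y i j assume R: "(x, i) \<in> ?R" "(y, j) \<in> ?R" "i < j"
      show "t - mdist X x y \<le> \<delta>"
      proof (cases "j < 4")
        case True
        then show ?thesis using R le ge by auto
      next
        case False
        then have "t \<le> \<delta>" using R(2) extra[of j] by auto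
        then show ?thesis using mdist_nonneg[of X x y] by linarith
      qed
    qed (use 4 in \<open>auto simp: X\<close>)
  qed
qed

lemma isometric_distances_eq:
  assumes "isometric X Y"
  shows "(\<lambda>(x, y). mdist X x y) ` (mspace X \<times> mspace X) =
    (\<lambda>(x, y). mdist Y x y) ` (mspace Y \<times> mspace Y)"
proof -
  obtain f where f: "isometric_embedding X Y f" "f ` mspace X = mspace Y"
    using assms by (auto simp: isometric_def)
  have "mspace Y \<times> mspace Y = map_prod f f ` (mspace X \<times> mspace X)"
    by (simp add: f(2)[symmetric] map_prod_surj_on)
  then show ?thesis
    using f(1) by (auto simp: image_image isometric_embedding_def intro!: image_cong)
qed

text \<open>The edge \<open>ps\<close> is moved to the midpoint of \<open>ps\<close> and \<open>qr\<close>. This keeps it between the shortest cross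
  edge and the diameter, and it is a value that does not occur as a distance in \<open>X\<close>.\<close>

lemma skew_quadruple_twin:
  fixes X :: "nat metric"
  assumes "skew_quadruple X p q r s"
  shows "\<exists>X' :: nat metric. card (mspace X') = 4 \<and> \<not> isometric X X' \<and>
      (\<forall>t m. t > 0 \<longrightarrow> m \<ge> 1 \<longrightarrow> GH_dist X (Delta t m) = GH_dist X' (Delta t m))"
proof -
  have X: "mspace X = {p, q, r, s}"
    and chain: "mdist X p q < mdist X r s" "mdist X r s < mdist X p r" "mdist X p r < mdist X p s"
     "mdist X p s < mdist X q r" "mdist X q r < mdist X q s" "mdist X q s < 2 * mdist X p q"
    using assms by (auto simp: skew_quadruple_def)
  define v where "v = (mdist X p s + mdist X q r) / 2"
  have v: "mdist X p s < v" "v < mdist X q r" using chain by (simp_all add: v_def)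
  from skew_quadruple_realization[of "mdist X p q" "mdist X r s" "mdist X p r" v "mdist X q r" "mdist X q s"]
  obtain X' :: "nat metric" where "skew_quadruple X' 0 1 2 3"
    and d: "mdist X' 0 1 = mdist X p q" "mdist X' 2 3 = mdist X r s" "mdist X' 0 2 = mdist X p r"
      "mdist X' 0 3 = v" "mdist X' 1 2 = mdist X q r" "mdist X' 1 3 = mdist X q s"
    using chain v by auto
  then have X': "mspace X' = {0, 1, 2, 3}" by (simp add: skew_quadruple_def)
  have "v \<in> (\<lambda>(x, y). mdist X' x y) ` (mspace X' \<times> mspace X')"
    using d(4) X' by force
  moreover have "v \<notin> (\<lambda>(x, y). mdist X x y) ` (mspace X \<times> mspace X)"
  proof
    assume "v \<in> (\<lambda>(x, y). mdist X x y) ` (mspace X \<times> mspace X)"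
    then obtain x y where xy: "x \<in> {p, q, r, s}" "y \<in> {p, q, r, s}" "v = mdist X x y"
      by (auto simp: X)
    have "mdist X p p = 0" "mdist X q q = 0" "mdist X r r = 0" "mdist X s s = 0"
      by (simp_all add: X)
    then have "mdist X x y \<in> {0, mdist X p q, mdist X r s, mdist X p r, mdist X p s,
        mdist X q r, mdist X q s}"
      using xy(1,2) mdist_commute[of X q p] mdist_commute[of X r p] mdist_commute[of X s p]
        mdist_commute[of X r q] mdist_commute[of X s q] mdist_commute[of X s r]
      by auto
    then show False using xy(3) v chain mdist_nonneg[of X p q] by auto
  qed
  ultimately have "\<not> isometric X X'" using isometric_distances_eq by metis
  moreover have "GH_dist X (Delta t m) = GH_dist X' (Delta t m)" if "t > 0" "m \<ge> 1" for t m
  proof -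
    have le: "mdist X p q \<le> mdist X r s" "mdist X r s \<le> mdist X p r"
      "mdist X p r \<le> mdist X p s" "mdist X p r \<le> mdist X q r"
      "mdist X p s \<le> mdist X q s" "mdist X q r \<le> mdist X q s" "mdist X p r \<le> mdist X q s"
      using chain by linarith+
    have le': "mdist X p r \<le> mdist X' 0 3" "mdist X p r \<le> mdist X' 1 2"
      "mdist X' 0 3 \<le> mdist X q s" "mdist X' 1 2 \<le> mdist X q s"
      unfolding d using chain v by linarith+
    have "GH_close X (Delta t m) \<delta> \<longleftrightarrow> GH_close X' (Delta t m) \<delta>" for \<delta>
      using GH_close_Delta_iff[OF X refl refl refl refl le that, of \<delta>]
        GH_close_Delta_iff[OF X' d(1,2,3,6) le(1,2) le' le(7) that, of \<delta>]
      by (simp only:)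
    then show ?thesis by (simp add: GH_dist_eq_INF)
  qed
  ultimately show ?thesis using X' by (intro exI[of _ X']) auto
qed

theorem corollary4p21:
  shows "\<exists>U. openin four_point_topology U \<and> U \<noteq> {} \<and>
    (\<forall>A\<in>U. \<forall>X\<in>A. \<exists>X' :: nat metric. card (mspace X') = 4 \<and> \<not> isometric X X' \<and>
      (\<forall>t m. t > 0 \<longrightarrow> m \<ge> 1 \<longrightarrow> GH_dist X (Delta t m) = GH_dist X' (Delta t m)))"
proof -
  interpret Metric_space four_point_space class_dist by (rule Metric_space_four_point)
  define U where "U = {A \<in> four_point_space. \<forall>X\<in>A. \<exists>p q r s. skew_quadruple X p q r s}"
  have card_class: "card (mspace Y) = 4" if "Y \<in> isometry_rel `` {X}" "card (mspace X) = 4" for X Y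
    using that isometric_card_eq[of X Y] by (simp add: isometry_rel_def)
  have "openin mtopology U"
    unfolding openin_mtopology
  proof (intro conjI allI impI)
    show "U \<subseteq> four_point_space" by (auto simp: U_def)
    fix A assume "A \<in> U"
    then obtain X where X: "A = isometry_rel `` {X}" "card (mspace X) = 4"
      by (auto simp: U_def four_point_space_iff)
    have "X \<in> A" by (simp add: X isometry_rel_def isometric_refl)
    then obtain p q r s where "skew_quadruple X p q r s" using \<open>A \<in> U\<close> by (auto simp: U_def)
    from skew_quadruple_stable[OF this]
    obtain \<epsilon> where "\<epsilon> > 0" and \<epsilon>: "\<forall>Y :: nat metric. card (mspace Y) = 4 \<longrightarrow> GH_close X Y \<epsilon> \<longrightarrow>
      (\<exists>p' q' r' s'. skew_quadruple Y p' q' r' s')" by blast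
    have "B \<in> U" if "B \<in> mball A (\<epsilon> / 2)" for B
    proof -
      have B: "B \<in> four_point_space" "class_dist A B < \<epsilon> / 2" using that by auto
      then obtain Y\<^sub>0 where Y\<^sub>0: "B = isometry_rel `` {Y\<^sub>0}" "card (mspace Y\<^sub>0) = 4"
        by (auto simp: four_point_space_iff)
      have "\<exists>p q r s. skew_quadruple Y p q r s" if "Y \<in> B" for Y
      proof -
        have "card (mspace Y) = 4" using card_class[of Y Y\<^sub>0] that Y\<^sub>0 by simp
        have "(Y\<^sub>0, Y) \<in> isometry_rel" using that Y\<^sub>0 by simp
        then have "B = isometry_rel `` {Y}" using equiv_class_eq[OF equiv_isometry_rel] Y\<^sub>0(1) by simp
        then have "enn2real (GH_dist X Y) < \<epsilon> / 2" using B(2) X(1) by (simp add: class_dist_eq)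
        from enn2real_less_imp_GH_close[OF _ _ _ _ this]
        have "GH_close X Y \<epsilon>"
          using card_eq_4_imp[OF X(2)] card_eq_4_imp[OF \<open>card (mspace Y) = 4\<close>] by simp
        with \<epsilon> \<open>card (mspace Y) = 4\<close> show ?thesis by blast
      qed
      with B(1) show ?thesis by (simp add: U_def)
    qed
    with \<open>\<epsilon> > 0\<close> show "\<exists>r>0. mball A r \<subseteq> U" by (intro exI[of _ "\<epsilon> / 2"]) auto
  qed
  moreover have "U \<noteq> {}"
  proof -
    obtain X :: "nat metric" where X: "skew_quadruple X 0 1 2 3"
      using skew_quadruple_realization[of 10 11 12 13 14 15] by auto
    then have card: "card (mspace X) = 4" by (simp add: skew_quadruple_def)
    \<comment> \<open>Membership in \<open>U\<close> concerns all representatives; they are at distortion zero from \<open>X\<close>.\<close>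
    from skew_quadruple_stable[OF X]
    obtain \<epsilon> where "\<epsilon> > 0" and \<epsilon>: "\<forall>Y :: nat metric. card (mspace Y) = 4 \<longrightarrow> GH_close X Y \<epsilon> \<longrightarrow>
      (\<exists>p' q' r' s'. skew_quadruple Y p' q' r' s')" by blast
    have "\<exists>p q r s. skew_quadruple Y p q r s" if "Y \<in> isometry_rel `` {X}" for Y
    proof -
      have "GH_close X Y 0" using that by (intro isometric_imp_GH_close) (simp add: isometry_rel_def)
      then have "GH_close X Y \<epsilon>" by (rule GH_close_mono) (use \<open>\<epsilon> > 0\<close> in simp)
      with \<epsilon> card_class[OF that card] show ?thesis by blast
    qed
    then have "isometry_rel `` {X} \<in> U" using card by (auto simp: U_def four_point_space_iff)
    then show ?thesis by blast
  qed
  moreover have "\<forall>A\<in>U. \<forall>X\<in>A. \<exists>X' :: nat metric. card (mspace X') = 4 \<and> \<not> isometric X X' \<and>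
      (\<forall>t m. t > 0 \<longrightarrow> m \<ge> 1 \<longrightarrow> GH_dist X (Delta t m) = GH_dist X' (Delta t m))"
    using skew_quadruple_twin by (auto simp: U_def)
  ultimately show ?thesis unfolding four_point_topology_def by blast
qed

end
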